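(* Let $\Bbbk$ be a subfield of $\mathbb{C}$ and $A$ a positively based $\Bbbk$-algebra of finite dimension $n$. Let $\mathcal{I}$ be a two-sided cell and $\mathcal{J}=\mathcal{J}(\mathcal{I})$ its apex. Assume that $M(\mathcal{I})$ is an $A_{\mathcal{J}}$-module, that is, $I_{\mathcal{J}}\cdot M(\mathcal{I})=0$. Then the left cells in $\mathcal{I}$ are pairwise not comparable with respect to the left order: if $\mathcal{L}\neq\mathcal{L}'$ are left cells in $\mathcal{I}$, then neither $\mathcal{L}\le_L\mathcal{L}'$ nor $\mathcal{L}'\le_L\mathcal{L}$.
   Context: Positively based algebra: $A$ is a unital associative $\Bbbk$-algebra with a fixed basis $\mathbf{B}=\{a_1,\dots,a_n\}$ such that $a_ia_j=\sum_{k}\gamma_{i,j}^{(k)}a_k$ with all $\gamma_{i,j}^{(k)}\in\mathbb{R}_{\ge 0}$; it is assumed that $a_1$ is the unit of $A$. Modules are left modules. Cells: put $\mathbf{n}=\{1,\dots,n\}$ and $i\star j=\{k:\gamma_{i,j}^{(k)}>0\}$, extended to subsets by taking unions. Write $i\le_L j$ if $j\in s\star i$ for some $s\in\mathbf{n}$, and $i\le_J j$ if $j\in s_1\star i\star s_2$ for some $s_1,s_2\in\mathbf{n}$; these are preorders. The equivalence classes of the associated equivalence relations (where $i\sim j$ iff $i\le j$ and $j\le i$) are the left cells, respectively two-sided cells; each two-sided cell is a union of left cells. The preorders induce partial orders on the sets of left, respectively two-sided, cells; $i\le_J\mathcal{J}$ means $i\le_J j$ for (any) $j\in\mathcal{J}$,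 and similarly for $\geq_J$; $i>_J\mathcal{J}$ means $i\ge_J\mathcal{J}$ and $i\notin\mathcal{J}$. Cell module: for a left cell $\mathcal{L}$, let $\overline{\mathcal{L}}$ be the union of all left cells $\mathcal{L}'\ge_L\mathcal{L}$; the spans of $\{a_j:j\in\overline{\mathcal{L}}\}$ and of $\{a_j:j\in\overline{\mathcal{L}}\setminus\mathcal{L}\}$ are submodules of ${}_AA$, and $C_{\mathcal{L}}$ is the quotient of the first by the second. Apex: the apex $\mathcal{J}(\mathcal{L})$ of $C_{\mathcal{L}}$ is the maximum element, with respect to $\le_J$ (it exists), of the set of two-sided cells containing some $i$ with $a_i\cdot C_{\mathcal{L}}\ne0$. It depends only on the two-sided cell containing $\mathcal{L}$; for a two-sided cell $\mathcal{I}$ one sets $\mathcal{J}(\mathcal{I})=\mathcal{J}(\mathcal{L})$ for any left cell $\mathcal{L}$ in $\mathcal{I}$. $I_{\mathcal{J}}$ is the two-sided ideal of $A$ spanned by all $a_i$ with $i\not\le_J\mathcal{J}$, and $A_{\mathcal{J}}=A/I_{\mathcal{J}}$. $M(\mathcal{I})$ is the left $A$-module $X/Y$, where $X$ is the span of all $a_i$ with $i\ge_J\mathcal{I}$ and $Y$ is the span of all $a_i$ with $i>_J\mathcal{I}$. *)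

theory Defs
  imports "HOL-Algebra.Algebra" "HOL-Algebra.Algebraic_Closure_Type"
begin

section \<open>Positively based algebras\<close>

abbreviation subfield_ring :: "complex set \<Rightarrow> complex ring" where
  "subfield_ring K \<equiv> ring_of_type_algebra\<lparr>carrier := K\<rparr>"

text \<open>
  The locale \<^locale>\<open>algebra\<close> of HOL-Algebra requires commutativity, so the conditions on a
  possibly noncommutative unital associative algebra are spelled out. The structure constant
  \<open>\<gamma> i j k\<close> is the coefficient of \<open>a k\<close> in \<open>a i \<otimes> a j\<close>; indices range over
  \<open>{1..n}\<close>, and values of \<open>a\<close> and \<open>\<gamma>\<close> outside this range are irrelevant.
\<close>

locale positively_based_algebra =
  ring A + scalars: module "subfield_ring K" A
  for K :: "complex set" and A :: "(complex, 'a) module" (structure) +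
  fixes n :: nat and a :: "nat \<Rightarrow> 'a" and \<gamma> :: "nat \<Rightarrow> nat \<Rightarrow> nat \<Rightarrow> real"
  assumes scalars_subfield: "subfield K (ring_of_type_algebra :: complex ring)"
    and smult_mult_left: "\<lbrakk>c \<in> K; x \<in> carrier A; y \<in> carrier A\<rbrakk>
          \<Longrightarrow> (c \<odot> x) \<otimes> y = c \<odot> (x \<otimes> y)"
    and smult_mult_right: "\<lbrakk>c \<in> K; x \<in> carrier A; y \<in> carrier A\<rbrakk>
          \<Longrightarrow> x \<otimes> (c \<odot> y) = c \<odot> (x \<otimes> y)"
    and dim_pos: "1 \<le> n"
    and basis_closed: "a \<in> {1..n} \<rightarrow> carrier A"
    and basis: "x \<in> carrier A
          \<Longrightarrow> \<exists>!c. c \<in> {1..n} \<rightarrow>\<^sub>E K \<and> x = (\<Oplus>i\<in>{1..n}. c i \<odot> a i)"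
    and basis_unit: "a 1 = \<one>"
    and constants_scalar: "\<lbrakk>i \<in> {1..n}; j \<in> {1..n}; k \<in> {1..n}\<rbrakk>
          \<Longrightarrow> complex_of_real (\<gamma> i j k) \<in> K"
    and constants_nonneg: "\<lbrakk>i \<in> {1..n}; j \<in> {1..n}; k \<in> {1..n}\<rbrakk> \<Longrightarrow> 0 \<le> \<gamma> i j k"
    and basis_mult: "\<lbrakk>i \<in> {1..n}; j \<in> {1..n}\<rbrakk>
          \<Longrightarrow> a i \<otimes> a j = (\<Oplus>k\<in>{1..n}. complex_of_real (\<gamma> i j k) \<odot> a k)"


section \<open>Cells\<close>

definition star :: "nat \<Rightarrow> (nat \<Rightarrow> nat \<Rightarrow> nat \<Rightarrow> real) \<Rightarrow> nat set \<Rightarrow> nat set \<Rightarrow> nat set" where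
  "star n \<gamma> S T = (\<Union>i\<in>S. \<Union>j\<in>T. {k \<in> {1..n}. \<gamma> i j k > 0})"

definition le_L :: "nat \<Rightarrow> (nat \<Rightarrow> nat \<Rightarrow> nat \<Rightarrow> real) \<Rightarrow> nat \<Rightarrow> nat \<Rightarrow> bool" where
  "le_L n \<gamma> i j \<longleftrightarrow> (\<exists>s\<in>{1..n}. j \<in> star n \<gamma> {s} {i})"

definition le_J :: "nat \<Rightarrow> (nat \<Rightarrow> nat \<Rightarrow> nat \<Rightarrow> real) \<Rightarrow> nat \<Rightarrow> nat \<Rightarrow> bool" where
  "le_J n \<gamma> i j \<longleftrightarrow>
    (\<exists>s\<^sub>1\<in>{1..n}. \<exists>s\<^sub>2\<in>{1..n}. j \<in> star n \<gamma> (star n \<gamma> {s\<^sub>1} {i}) {s\<^sub>2})"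

definition left_cells :: "nat \<Rightarrow> (nat \<Rightarrow> nat \<Rightarrow> nat \<Rightarrow> real) \<Rightarrow> nat set set" where
  "left_cells n \<gamma> =
    {1..n} // {(i, j) \<in> {1..n} \<times> {1..n}. le_L n \<gamma> i j \<and> le_L n \<gamma> j i}"

definition two_sided_cells :: "nat \<Rightarrow> (nat \<Rightarrow> nat \<Rightarrow> nat \<Rightarrow> real) \<Rightarrow> nat set set" where
  "two_sided_cells n \<gamma> =
    {1..n} // {(i, j) \<in> {1..n} \<times> {1..n}. le_J n \<gamma> i j \<and> le_J n \<gamma> j i}"

text \<open>The induced orders on cells do not depend on the choice of representatives.\<close>

definition cell_le_L ::
  "nat \<Rightarrow> (nat \<Rightarrow> nat \<Rightarrow> nat \<Rightarrow> real) \<Rightarrow> nat set \<Rightarrow> nat set \<Rightarrow> bool" where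
  "cell_le_L n \<gamma> L L' \<longleftrightarrow> (\<exists>i\<in>L. \<exists>j\<in>L'. le_L n \<gamma> i j)"

definition cell_le_J ::
  "nat \<Rightarrow> (nat \<Rightarrow> nat \<Rightarrow> nat \<Rightarrow> real) \<Rightarrow> nat set \<Rightarrow> nat set \<Rightarrow> bool" where
  "cell_le_J n \<gamma> I J \<longleftrightarrow> (\<exists>i\<in>I. \<exists>j\<in>J. le_J n \<gamma> i j)"


section \<open>Cell modules, apex, and the module of a two-sided cell\<close>

definition basis_span ::
  "complex set \<Rightarrow> (complex, 'a) module \<Rightarrow> (nat \<Rightarrow> 'a) \<Rightarrow> nat set \<Rightarrow> 'a set" where
  "basis_span K A a S = {(\<Oplus>\<^bsub>A\<^esub>j\<in>S. c j \<odot>\<^bsub>A\<^esub> a j) | c. c \<in> S \<rightarrow> K}"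

text \<open>
  The quotient \<open>V/W\<close> of left ideals \<open>W \<subseteq> V\<close> of \<open>A\<close>, as a left \<open>A\<close>-module of
  cosets: its scalar multiplication is the action of the ring \<open>A\<close>. The record type
  \<^typ>\<open>('a, 'b) module\<close> extends rings, hence the unused fields \<open>mult\<close> and \<open>one\<close>.
\<close>

definition quotient_module ::
  "(complex, 'a) module \<Rightarrow> 'a set \<Rightarrow> 'a set \<Rightarrow> ('a, 'a set) module" where
  "quotient_module A V W =
    \<lparr>carrier = (\<lambda>x. W +>\<^bsub>A\<^esub> x) ` V, monoid.mult = undefined, one = undefined,
     ring.zero = W, add = set_add A,
     module.smult = (\<lambda>r C. \<Union>x\<in>C. W +>\<^bsub>A\<^esub> (r \<otimes>\<^bsub>A\<^esub> x))\<rparr>"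

definition left_upper :: "nat \<Rightarrow> (nat \<Rightarrow> nat \<Rightarrow> nat \<Rightarrow> real) \<Rightarrow> nat set \<Rightarrow> nat set" where
  "left_upper n \<gamma> L = \<Union>{L' \<in> left_cells n \<gamma>. cell_le_L n \<gamma> L L'}"

definition cell_module ::
  "complex set \<Rightarrow> (complex, 'a) module \<Rightarrow> nat \<Rightarrow> (nat \<Rightarrow> 'a) \<Rightarrow> (nat \<Rightarrow> nat \<Rightarrow> nat \<Rightarrow> real)
    \<Rightarrow> nat set \<Rightarrow> ('a, 'a set) module" where
  "cell_module K A n a \<gamma> L =
    quotient_module A (basis_span K A a (left_upper n \<gamma> L))
                      (basis_span K A a (left_upper n \<gamma> L - L))"

definition acting_cells ::
  "complex set \<Rightarrow> (complex, 'a) module \<Rightarrow> nat \<Rightarrow> (nat \<Rightarrow> 'a) \<Rightarrow> (nat \<Rightarrow> nat \<Rightarrow> nat \<Rightarrow> real)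
    \<Rightarrow> nat set \<Rightarrow> nat set set" where
  "acting_cells K A n a \<gamma> L =
    {J \<in> two_sided_cells n \<gamma>. \<exists>i\<in>J. \<exists>v\<in>carrier (cell_module K A n a \<gamma> L).
       a i \<odot>\<^bsub>cell_module K A n a \<gamma> L\<^esub> v \<noteq> \<zero>\<^bsub>cell_module K A n a \<gamma> L\<^esub>}"

definition is_apex ::
  "complex set \<Rightarrow> (complex, 'a) module \<Rightarrow> nat \<Rightarrow> (nat \<Rightarrow> 'a) \<Rightarrow> (nat \<Rightarrow> nat \<Rightarrow> nat \<Rightarrow> real)
    \<Rightarrow> nat set \<Rightarrow> nat set \<Rightarrow> bool" where
  "is_apex K A n a \<gamma> L J \<longleftrightarrow>
    J \<in> acting_cells K A n a \<gamma> L \<and> (\<forall>J'\<in>acting_cells K A n a \<gamma> L. cell_le_J n \<gamma> J' J)"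

text \<open>
  All left cells in a two-sided cell \<open>I\<close> have the same apex, so it may be computed from any
  one of them.
\<close>

definition is_apex_two_sided ::
  "complex set \<Rightarrow> (complex, 'a) module \<Rightarrow> nat \<Rightarrow> (nat \<Rightarrow> 'a) \<Rightarrow> (nat \<Rightarrow> nat \<Rightarrow> nat \<Rightarrow> real)
    \<Rightarrow> nat set \<Rightarrow> nat set \<Rightarrow> bool" where
  "is_apex_two_sided K A n a \<gamma> I J \<longleftrightarrow>
    (\<exists>L\<in>left_cells n \<gamma>. L \<subseteq> I \<and> is_apex K A n a \<gamma> L J)"

definition apex_ideal ::
  "complex set \<Rightarrow> (complex, 'a) module \<Rightarrow> nat \<Rightarrow> (nat \<Rightarrow> 'a) \<Rightarrow> (nat \<Rightarrow> nat \<Rightarrow> nat \<Rightarrow> real)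
    \<Rightarrow> nat set \<Rightarrow> 'a set" where
  "apex_ideal K A n a \<gamma> J = basis_span K A a {i \<in> {1..n}. \<not> (\<exists>j\<in>J. le_J n \<gamma> i j)}"

definition two_sided_cell_module ::
  "complex set \<Rightarrow> (complex, 'a) module \<Rightarrow> nat \<Rightarrow> (nat \<Rightarrow> 'a) \<Rightarrow> (nat \<Rightarrow> nat \<Rightarrow> nat \<Rightarrow> real)
    \<Rightarrow> nat set \<Rightarrow> ('a, 'a set) module" where
  "two_sided_cell_module K A n a \<gamma> I =
    quotient_module A (basis_span K A a {i \<in> {1..n}. \<exists>j\<in>I. le_J n \<gamma> j i})
                      (basis_span K A a {i \<in> {1..n}. (\<exists>j\<in>I. le_J n \<gamma> j i) \<and> i \<notin> I})"

end

theory Submission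
  imports Defs
begin

text \<open>
  Let \<open>C\<close> be a two-sided cell and let \<open>\<Gamma>\<close> be the sum of all basis elements. Left and right
  multiplication by \<open>\<Gamma>\<close> on the bimodule of \<open>C\<close> are given by nonnegative matrices \<open>Q\<close> and \<open>R\<close>
  indexed by \<open>C\<close>. They commute because multiplication is associative, and \<open>R Q\<close> is entrywise
  positive because any two elements of \<open>C\<close> are below each other in the two-sided order. The
  entry of \<open>Q\<close> at \<open>(k, l)\<close> is positive exactly if \<open>l \<le>\<^sub>L k\<close>, so the left order makes \<open>Q\<close> block
  triangular, and incomparability of the left cells in \<open>C\<close> says that \<open>Q\<close> is block diagonal.

  Thus everything rests on a fact about nonnegative matrices, the lemma
  \<open>commuting_positive_imp_decoupled\<close>: if \<open>Q\<close> commutes with an entrywise positive matrix \<open>P\<close>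
  and is block triangular, then it is block diagonal. The conceptual reason is that the
  one-dimensional Perron-Frobenius eigenspaces of \<open>P\<close> are preserved by \<open>Q\<close>. So \<open>Q\<close> has a positive
  right and a positive left eigenvector, and pairing the two shows that no weight can pass from one
  diagonal block to another. The proof replaces eigenvectors by growth rates. Commuting
  with \<open>P\<close> forces every row sum and every column sum of a power of \<open>Q\<close> to be at least a fixed
  fraction of the sum \<open>s c\<close> of all entries of \<open>Q ^ c\<close> (\<open>line_sums_comparable\<close>). An off-diagonal
  entry from \<open>i\<close> to \<open>k\<close> can be crossed at any one of \<open>m\<close> times in a walk of length \<open>m\<close>, but, by
  triangularity, at most once in each walk. Hence \<open>s m\<close> is at least a constant times
  \<open>m * s (m - 1)\<close>, whereas \<open>s m \<le> s 1 * s (m - 1)\<close>. For large \<open>m\<close> this is a contradiction.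

  In terms of cells this yields a stability property in the style of finite semigroups
  (\<open>left_comparable_imp_left_equivalent\<close>): \<open>i \<le>\<^sub>L j\<close> and \<open>j \<le>\<^sub>J i\<close> together imply \<open>j \<le>\<^sub>L i\<close>.
\<close>

section \<open>Nonnegative matrices commuting with a positive matrix\<close>

text \<open>
  The matrices are functions restricted to a finite index set, since the index set in the
  application is a two-sided cell and so not a type. The entry at \<open>(i, j)\<close> is thought of as the
  weight of a step from \<open>j\<close> to \<open>i\<close>.
\<close>

definition mat_mult_on :: "'i set \<Rightarrow> ('i \<Rightarrow> 'i \<Rightarrow> real) \<Rightarrow> ('i \<Rightarrow> 'i \<Rightarrow> real) \<Rightarrow> 'i \<Rightarrow> 'i \<Rightarrow> real" where
  "mat_mult_on S F G i j = (\<Sum>k\<in>S. F i k * G k j)"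

primrec mat_pow_on :: "'i set \<Rightarrow> ('i \<Rightarrow> 'i \<Rightarrow> real) \<Rightarrow> nat \<Rightarrow> 'i \<Rightarrow> 'i \<Rightarrow> real" where
  "mat_pow_on S F 0 = (\<lambda>i j. if i = j then 1 else 0)"
| "mat_pow_on S F (Suc c) = mat_mult_on S F (mat_pow_on S F c)"

lemma mat_mult_on_assoc: "mat_mult_on S (mat_mult_on S F G) H i j = mat_mult_on S F (mat_mult_on S G H) i j"
  by (simp add: mat_mult_on_def sum_distrib_left sum_distrib_right mult.assoc) (rule sum.swap)

lemma mat_mult_on_cong:
  assumes "\<And>k. k \<in> S \<Longrightarrow> F i k = F' i k" "\<And>k. k \<in> S \<Longrightarrow> G k j = G' k j"
  shows "mat_mult_on S F G i j = mat_mult_on S F' G' i j"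
  using assms by (simp add: mat_mult_on_def cong: sum.cong)

lemma mat_pow_on_commute:
  assumes "finite S" and comm: "\<And>i j. i \<in> S \<Longrightarrow> j \<in> S \<Longrightarrow> mat_mult_on S F G i j = mat_mult_on S G F i j"
    and "i \<in> S" "j \<in> S"
  shows "mat_mult_on S (mat_pow_on S F c) G i j = mat_mult_on S G (mat_pow_on S F c) i j"
  using \<open>i \<in> S\<close>
proof (induction c arbitrary: i)
  case 0
  then show ?case
    using assms by (simp add: mat_mult_on_def if_distrib if_distribR sum.delta sum.delta' cong: if_cong)
next
  case (Suc c)
  have "mat_mult_on S (mat_pow_on S F (Suc c)) G i j = mat_mult_on S F (mat_mult_on S (mat_pow_on S F c) G) i j"
    by (simp add: mat_mult_on_assoc)
  also have "\<dots> = mat_mult_on S F (mat_mult_on S G (mat_pow_on S F c)) i j"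
    using Suc.IH by (simp add: mat_mult_on_def[of S F])
  also have "\<dots> = mat_mult_on S (mat_mult_on S F G) (mat_pow_on S F c) i j"
    by (simp add: mat_mult_on_assoc)
  also have "\<dots> = mat_mult_on S (mat_mult_on S G F) (mat_pow_on S F c) i j"
    by (rule mat_mult_on_cong) (use Suc.prems comm in auto)
  also have "\<dots> = mat_mult_on S G (mat_pow_on S F (Suc c)) i j"
    by (simp add: mat_mult_on_assoc)
  finally show ?case .
qed

lemma mat_pow_on_add:
  assumes "finite S" "i \<in> S" "j \<in> S"
  shows "mat_pow_on S F (b + c) i j = mat_mult_on S (mat_pow_on S F b) (mat_pow_on S F c) i j"
  using \<open>i \<in> S\<close>
proof (induction b arbitrary: i)
  case 0
  then show ?case
    using assms by (simp add: mat_mult_on_def if_distrib if_distribR sum.delta sum.delta' cong: if_cong)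
next
  case (Suc b)
  have "mat_pow_on S F (Suc b + c) i j = mat_mult_on S F (mat_mult_on S (mat_pow_on S F b) (mat_pow_on S F c)) i j"
    using Suc.IH by (simp add: mat_mult_on_def)
  then show ?case
    by (simp add: mat_mult_on_assoc)
qed

lemma mat_pow_on_nonneg:
  assumes "\<And>i j. i \<in> S \<Longrightarrow> j \<in> S \<Longrightarrow> 0 \<le> F i j" "i \<in> S" "j \<in> S"
  shows "0 \<le> mat_pow_on S F c i j"
  using \<open>i \<in> S\<close>
  by (induction c arbitrary: i) (use assms in \<open>auto simp: mat_mult_on_def intro!: sum_nonneg\<close>)

text \<open>
  All entries of \<open>P\<close> lie between \<open>p\<close> and \<open>p'\<close>, so each entry of \<open>T P\<close> is comparable with the sum
  of its row in \<open>T\<close>, and each entry of \<open>P T\<close> with the sum of its column in \<open>T\<close>. As the two products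
  agree, any row sum of \<open>T\<close> is comparable with any column sum.
\<close>

lemma line_sums_comparable:
  fixes P T :: "'i \<Rightarrow> 'i \<Rightarrow> real" and p p' :: real
  assumes P: "\<And>i j. i \<in> S \<Longrightarrow> j \<in> S \<Longrightarrow> p \<le> P i j \<and> P i j \<le> p'"
    and T: "\<And>i j. i \<in> S \<Longrightarrow> j \<in> S \<Longrightarrow> 0 \<le> T i j"
    and comm: "\<And>i j. i \<in> S \<Longrightarrow> j \<in> S \<Longrightarrow> mat_mult_on S T P i j = mat_mult_on S P T i j"
    and "k \<in> S"
  shows "p * (\<Sum>i\<in>S. \<Sum>j\<in>S. T i j) \<le> card S * p' * (\<Sum>i\<in>S. T i k)"
    and "p * (\<Sum>i\<in>S. \<Sum>j\<in>S. T i j) \<le> card S * p' * (\<Sum>j\<in>S. T k j)"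
proof -
  define col where "col j = (\<Sum>i\<in>S. T i j)" for j
  define row where "row i = (\<Sum>j\<in>S. T i j)" for i
  have TP: "p * row i \<le> mat_mult_on S T P i j" "mat_mult_on S T P i j \<le> p' * row i" if "i \<in> S" "j \<in> S" for i j
    unfolding mat_mult_on_def row_def sum_distrib_left
    using that P T by (auto intro!: sum_mono simp: mult.commute[of "T _ _"] mult_right_mono)
  have PT: "p * col j \<le> mat_mult_on S P T i j" "mat_mult_on S P T i j \<le> p' * col j" if "i \<in> S" "j \<in> S" for i j
    unfolding mat_mult_on_def col_def sum_distrib_left
    using that P T by (auto intro!: sum_mono mult_right_mono)
  have "p * (\<Sum>i\<in>S. \<Sum>j\<in>S. T i j) = (\<Sum>i\<in>S. p * row i)"
    by (simp add: row_def sum_distrib_left)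
  also have "\<dots> \<le> (\<Sum>i\<in>S. p' * col k)"
    using TP(1)[OF _ \<open>k \<in> S\<close>] PT(2)[OF _ \<open>k \<in> S\<close>] comm[OF _ \<open>k \<in> S\<close>]
    by (intro sum_mono) force
  finally show "p * (\<Sum>i\<in>S. \<Sum>j\<in>S. T i j) \<le> card S * p' * (\<Sum>i\<in>S. T i k)"
    by (simp add: col_def)
  have "p * (\<Sum>i\<in>S. \<Sum>j\<in>S. T i j) = (\<Sum>j\<in>S. p * col j)"
    by (subst sum.swap) (simp add: col_def sum_distrib_left)
  also have "\<dots> \<le> (\<Sum>i\<in>S. p' * row k)"
    using PT(1)[OF \<open>k \<in> S\<close>] TP(2)[OF \<open>k \<in> S\<close>] comm[OF \<open>k \<in> S\<close>]
    by (intro sum_mono) force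
  finally show "p * (\<Sum>i\<in>S. \<Sum>j\<in>S. T i j) \<le> card S * p' * (\<Sum>j\<in>S. T k j)"
    by (simp add: row_def)
qed

text \<open>
  The hypothesis on \<open>V\<close> says that a walk cannot enter \<open>V\<close> from outside; the conclusion is that it
  cannot leave \<open>V\<close> either. A step out of \<open>V\<close> would be taken at most once in a walk, at any of
  its times, which makes the total weight of walks of length \<open>m\<close> grow faster than exponentially
  in \<open>m\<close>.
\<close>

lemma commuting_positive_imp_decoupled:
  fixes Q P :: "'i \<Rightarrow> 'i \<Rightarrow> real"
  assumes "finite S"
    and Q: "\<And>i j. i \<in> S \<Longrightarrow> j \<in> S \<Longrightarrow> 0 \<le> Q i j"
    and P: "\<And>i j. i \<in> S \<Longrightarrow> j \<in> S \<Longrightarrow> 0 < P i j"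
    and comm: "\<And>i j. i \<in> S \<Longrightarrow> j \<in> S \<Longrightarrow> mat_mult_on S Q P i j = mat_mult_on S P Q i j"
    and "V \<subseteq> S"
    and block: "\<And>k l. k \<in> V \<Longrightarrow> l \<in> S - V \<Longrightarrow> Q k l = 0"
    and i: "i \<in> V" and k: "k \<in> S - V"
  shows "Q k i = 0"
proof (rule ccontr)
  assume "Q k i \<noteq> 0"
  then have q: "0 < Q k i"
    using Q[of k i] i k \<open>V \<subseteq> S\<close> by force
  have iS: "i \<in> S" and kS: "k \<in> S" using i k \<open>V \<subseteq> S\<close> by auto
  define T where "T = mat_pow_on S Q"
  define row where "row c i = (\<Sum>j\<in>S. T c i j)" for c i
  define col where "col c j = (\<Sum>i\<in>S. T c i j)" for c j
  define s where "s c = (\<Sum>i\<in>S. row c i)" for c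
  have T_nonneg: "0 \<le> T c i j" if "i \<in> S" "j \<in> S" for c i j
    unfolding T_def by (rule mat_pow_on_nonneg) (use Q that in auto)
  have row_nonneg: "0 \<le> row c i" if "i \<in> S" for c i
    unfolding row_def using T_nonneg that by (intro sum_nonneg)
  have col_nonneg: "0 \<le> col c i" if "i \<in> S" for c i
    unfolding col_def using T_nonneg that by (intro sum_nonneg)
  have s_col: "s c = (\<Sum>j\<in>S. col c j)" for c
    unfolding s_def row_def col_def by (rule sum.swap)
  have s_nonneg: "0 \<le> s c" for c
    unfolding s_def using row_nonneg by (intro sum_nonneg)

  define entries where "entries = (\<lambda>(i, j). P i j) ` (S \<times> S)"
  have entries: "finite entries" "entries \<noteq> {}"
    using \<open>finite S\<close> iS by (auto simp: entries_def)
  define p p' where "p = Min entries" and "p' = Max entries"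
  have p: "0 < p"
    unfolding p_def using entries P by (subst Min_gr_iff) (auto simp: entries_def)
  have pp': "p \<le> P i j \<and> P i j \<le> p'" if "i \<in> S" "j \<in> S" for i j
  proof -
    have "P i j \<in> entries" unfolding entries_def using that by force
    then show ?thesis using entries by (simp add: p_def p'_def)
  qed
  have "0 < p'" using p pp'[OF iS iS] by linarith
  define \<delta> where "\<delta> = p / (card S * p')"
  have cS: "0 < card S" using \<open>finite S\<close> iS card_gt_0_iff by blast
  have \<delta>: "0 < \<delta>"
    using p \<open>0 < p'\<close> cS by (simp add: \<delta>_def)
  have lines: "\<delta> * s c \<le> col c l" "\<delta> * s c \<le> row c l" if "l \<in> S" for c l
  proof -
    have "mat_mult_on S (T c) P i j = mat_mult_on S P (T c) i j" if "i \<in> S" "j \<in> S" for i j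
      unfolding T_def using \<open>finite S\<close> comm that by (rule mat_pow_on_commute)
    note * = line_sums_comparable[OF pp' T_nonneg this \<open>l \<in> S\<close>]
    show "\<delta> * s c \<le> col c l" "\<delta> * s c \<le> row c l"
      using * \<open>0 < p'\<close> cS
      by (simp_all add: \<delta>_def s_def row_def col_def field_simps)
  qed

  have s_add: "s (b + c) = (\<Sum>l\<in>S. col b l * row c l)" for b c
  proof -
    have "s (b + c) = (\<Sum>i\<in>S. \<Sum>j\<in>S. \<Sum>l\<in>S. T b i l * T c l j)"
      unfolding s_def row_def T_def
      using mat_pow_on_add[OF \<open>finite S\<close>] by (simp add: mat_mult_on_def)
    also have "\<dots> = (\<Sum>i\<in>S. \<Sum>l\<in>S. \<Sum>j\<in>S. T b i l * T c l j)"
      by (intro sum.cong refl sum.swap)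
    also have "\<dots> = (\<Sum>l\<in>S. \<Sum>i\<in>S. \<Sum>j\<in>S. T b i l * T c l j)"
      by (rule sum.swap)
    finally show ?thesis
      by (simp add: col_def row_def sum_product)
  qed
  have s_mult: "s (b + c) \<le> s b * s c" for b c
  proof -
    have "row c l \<le> s c" if "l \<in> S" for l
      unfolding s_def using that row_nonneg \<open>finite S\<close> by (intro member_le_sum) auto
    then show ?thesis
      unfolding s_add s_col[of b] sum_distrib_right
      using col_nonneg by (intro sum_mono mult_left_mono) auto
  qed
  have row_Suc: "row (Suc c) l = (\<Sum>j\<in>S. Q l j * row c j)" for c l
    unfolding row_def T_def mat_pow_on.simps mat_mult_on_def sum_distrib_left by (rule sum.swap)
  have col_Suc: "col (Suc c) j = (\<Sum>l\<in>S. col c l * Q l j)" if "j \<in> S" for c j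
  proof -
    have "mat_mult_on S Q (T c) i j = mat_mult_on S (T c) Q i j" if "i \<in> S" for i
      unfolding T_def using mat_pow_on_commute[OF \<open>finite S\<close> _ that \<open>j \<in> S\<close>, of Q Q] by simp
    then have "col (Suc c) j = (\<Sum>i\<in>S. \<Sum>l\<in>S. T c i l * Q l j)"
      unfolding col_def T_def by (simp add: mat_mult_on_def)
    also have "\<dots> = (\<Sum>l\<in>S. \<Sum>i\<in>S. T c i l * Q l j)"
      by (rule sum.swap)
    finally show ?thesis by (simp add: col_def sum_distrib_right)
  qed

  \<comment> \<open>the total weight of the walks of length \<open>b + c\<close> that are in \<open>V\<close> after \<open>c\<close> steps\<close>
  define h where "h b c = (\<Sum>l\<in>V. col b l * row c l)" for b c
  define \<epsilon> where "\<epsilon> = \<delta> * \<delta> * Q k i"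
  have \<epsilon>: "0 < \<epsilon>" using \<delta> q by (simp add: \<epsilon>_def)
  have finV: "finite V" using \<open>finite S\<close> \<open>V \<subseteq> S\<close> finite_subset by blast
  have h_nonneg: "0 \<le> h b c" for b c
    unfolding h_def using col_nonneg row_nonneg \<open>V \<subseteq> S\<close> by (intro sum_nonneg) auto
  have h_le: "h b c \<le> s (b + c)" for b c
    unfolding h_def s_add using col_nonneg row_nonneg \<open>V \<subseteq> S\<close> \<open>finite S\<close> by (intro sum_mono2) auto
  \<comment> \<open>A walk that is in \<open>V\<close> after \<open>c + 1\<close> steps was there one step earlier. The additional summand
    is a lower bound for the weight of the walks that leave \<open>V\<close> from \<open>i\<close> to \<open>k\<close> at this time.\<close>
  have h_step: "h b (Suc c) + \<epsilon> * s (b + c) \<le> h (Suc b) c" for b c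
  proof -
    have into_V: "row (Suc c) l = (\<Sum>j\<in>V. Q l j * row c j)" if "l \<in> V" for l
      unfolding row_Suc using \<open>finite S\<close> \<open>V \<subseteq> S\<close> block[OF that] by (intro sum.mono_neutral_right) auto
    have "\<epsilon> * s (b + c) \<le> \<epsilon> * (s b * s c)"
      using s_mult \<epsilon> by (intro mult_left_mono) auto
    also have "\<dots> = (\<delta> * s b) * Q k i * (\<delta> * s c)"
      by (simp add: \<epsilon>_def)
    also have "\<dots> \<le> col b k * Q k i * row c i"
      using lines iS kS q \<delta> s_nonneg col_nonneg by (intro mult_mono) auto
    also have "\<dots> \<le> (\<Sum>j\<in>V. col b k * Q k j * row c j)"
      using i finV kS \<open>V \<subseteq> S\<close> col_nonneg row_nonneg Q
      by (intro member_le_sum[of i V "\<lambda>j. col b k * Q k j * row c j"]) auto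
    finally have k_term: "\<epsilon> * s (b + c) \<le> (\<Sum>j\<in>V. col b k * Q k j * row c j)" .
    have "h b (Suc c) = (\<Sum>l\<in>V. \<Sum>j\<in>V. col b l * Q l j * row c j)"
      unfolding h_def using into_V by (simp add: sum_distrib_left mult.assoc)
    then have "h b (Suc c) + \<epsilon> * s (b + c) \<le> (\<Sum>l\<in>insert k V. \<Sum>j\<in>V. col b l * Q l j * row c j)"
      using k finV k_term by simp
    also have "\<dots> \<le> (\<Sum>l\<in>S. \<Sum>j\<in>V. col b l * Q l j * row c j)"
      using kS \<open>V \<subseteq> S\<close> \<open>finite S\<close> col_nonneg row_nonneg Q
      by (intro sum_mono2 sum_nonneg mult_nonneg_nonneg) auto
    also have "\<dots> = (\<Sum>j\<in>V. \<Sum>l\<in>S. col b l * Q l j * row c j)"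
      by (rule sum.swap)
    also have "\<dots> = h (Suc b) c"
      unfolding h_def using col_Suc \<open>V \<subseteq> S\<close> by (intro sum.cong) (auto simp: sum_distrib_right)
    finally show ?thesis .
  qed
  have linear: "real b * \<epsilon> * s (b + c - 1) \<le> h b c" for b c
  proof (induction b arbitrary: c)
    case 0
    then show ?case using h_nonneg by simp
  next
    case (Suc b)
    have "real (Suc b) * \<epsilon> * s (b + c) = real b * \<epsilon> * s (b + Suc c - 1) + \<epsilon> * s (b + c)"
      by (simp add: algebra_simps)
    also have "\<dots> \<le> h (Suc b) c"
      using Suc.IH[of "Suc c"] h_step[of b c] by linarith
    finally show ?case by simp
  qed
  have growth: "real (Suc m) * \<epsilon> * s m \<le> s (Suc m)" for m
    using linear[of "Suc m" 0] h_le[of "Suc m" 0] by simp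
  have s_pos: "0 < s m" for m
  proof (induction m)
    case 0
    have "s 0 = real (card S)"
      using \<open>finite S\<close> by (simp add: s_def row_def T_def)
    then show ?case using cS by simp
  next
    case (Suc m)
    then have "0 < real (Suc m) * \<epsilon> * s m" using \<epsilon> by simp
    then show ?case using growth[of m] by linarith
  qed
  obtain m :: nat where m: "s 1 < real m * \<epsilon>"
    using \<epsilon> reals_Archimedean3 by blast
  have "real (Suc m) * \<epsilon> * s m \<le> s 1 * s m"
    using growth[of m] s_mult[of 1 m] by simp
  then have "real (Suc m) * \<epsilon> \<le> s 1"
    using s_pos by (simp add: mult_le_cancel_right_pos)
  then show False
    using m \<epsilon> by (simp add: algebra_simps)
qed

section \<open>Structure constants\<close>

context positively_based_algebra
begin

lemma basis_in_carrier: "i \<in> {1..n} \<Longrightarrow> a i \<in> carrier A"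
  using basis_closed by auto

lemma smult_in_carrier: "c \<in> K \<Longrightarrow> x \<in> carrier A \<Longrightarrow> c \<odot> x \<in> carrier A"
  using scalars.smult_closed by simp

lemma scalar_zero: "0 \<in> K" and scalar_one: "1 \<in> K"
  and scalar_add: "c \<in> K \<Longrightarrow> d \<in> K \<Longrightarrow> c + d \<in> K"
  and scalar_mult: "c \<in> K \<Longrightarrow> d \<in> K \<Longrightarrow> c * d \<in> K"
proof -
  have K: "subring K (ring_of_type_algebra :: complex ring)"
    using scalars_subfield by (intro subcring.axioms(1) subdomain.axioms(1) subfield.axioms(1))
  show "0 \<in> K" "1 \<in> K" "c \<in> K \<Longrightarrow> d \<in> K \<Longrightarrow> c + d \<in> K"
    "c \<in> K \<Longrightarrow> d \<in> K \<Longrightarrow> c * d \<in> K"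
    using subringE(2,3,6,7)[OF K]
    by (simp_all add: ring_of_type_algebra_def)
qed

lemma scalar_sum: "(\<And>m. m \<in> S \<Longrightarrow> c m \<in> K) \<Longrightarrow> sum c S \<in> K"
  by (induction S rule: infinite_finite_induct) (simp_all add: scalar_zero scalar_add)

lemma smult_add_left: "c \<in> K \<Longrightarrow> d \<in> K \<Longrightarrow> x \<in> carrier A \<Longrightarrow> (c + d) \<odot> x = c \<odot> x \<oplus> d \<odot> x"
  using scalars.smult_l_distr by (simp add: ring_of_type_algebra_def)

lemma smult_smult: "c \<in> K \<Longrightarrow> d \<in> K \<Longrightarrow> x \<in> carrier A \<Longrightarrow> (c * d) \<odot> x = c \<odot> (d \<odot> x)"
  using scalars.smult_assoc1 by (simp add: ring_of_type_algebra_def)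

lemma smult_zero_left: "x \<in> carrier A \<Longrightarrow> 0 \<odot> x = \<zero>"
  using scalars.smult_l_null by (simp add: ring_of_type_algebra_def)

lemma smult_one_left: "x \<in> carrier A \<Longrightarrow> 1 \<odot> x = x"
  using scalars.smult_one by (simp add: ring_of_type_algebra_def)

lemma smult_finsum:
  "finite S \<Longrightarrow> c \<in> K \<Longrightarrow> f \<in> S \<rightarrow> carrier A \<Longrightarrow> c \<odot> (\<Oplus>i\<in>S. f i) = (\<Oplus>i\<in>S. c \<odot> f i)"
  using scalars.finsum_smult_ldistr by simp

lemma coefficients_unique:
  assumes "c \<in> {1..n} \<rightarrow> K" "d \<in> {1..n} \<rightarrow> K"
    and eq: "(\<Oplus>i\<in>{1..n}. c i \<odot> a i) = (\<Oplus>i\<in>{1..n}. d i \<odot> a i)" and "k \<in> {1..n}"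
  shows "c k = d k"
proof -
  let ?x = "\<Oplus>i\<in>{1..n}. c i \<odot> a i"
  have cl: "(\<lambda>i. e i \<odot> a i) \<in> {1..n} \<rightarrow> carrier A" if "e \<in> {1..n} \<rightarrow> K" for e
    using that basis_in_carrier by (auto intro!: smult_in_carrier)
  have r: "(\<Oplus>i\<in>{1..n}. restrict e {1..n} i \<odot> a i) = (\<Oplus>i\<in>{1..n}. e i \<odot> a i)"
    if "e \<in> {1..n} \<rightarrow> K" for e
    by (rule finsum_cong') (use cl[OF that] in auto)
  have "?x \<in> carrier A"
    using cl[OF assms(1)] by (rule finsum_closed)
  then have "\<exists>!e. e \<in> {1..n} \<rightarrow>\<^sub>E K \<and> ?x = (\<Oplus>i\<in>{1..n}. e i \<odot> a i)"
    by (rule basis)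
  moreover have "restrict c {1..n} \<in> {1..n} \<rightarrow>\<^sub>E K" "restrict d {1..n} \<in> {1..n} \<rightarrow>\<^sub>E K"
    using assms by auto
  ultimately have "restrict c {1..n} = restrict d {1..n}"
    using r[OF assms(1)] r[OF assms(2)] eq by metis
  then show ?thesis
    using \<open>k \<in> {1..n}\<close> by (metis restrict_apply')
qed

text \<open>
  This turns the associative law for three basis elements into an identity between coordinates.
\<close>

lemma linear_combination_of_linear_combinations:
  assumes "finite S" "d \<in> S \<rightarrow> K" "\<And>m. m \<in> S \<Longrightarrow> e m \<in> {1..n} \<rightarrow> K"
  shows "(\<Oplus>m\<in>S. d m \<odot> (\<Oplus>l\<in>{1..n}. e m l \<odot> a l)) = (\<Oplus>l\<in>{1..n}. (\<Sum>m\<in>S. d m * e m l) \<odot> a l)"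
  using assms
proof (induction S rule: finite_induct)
  case empty
  have "(\<Oplus>l\<in>{1..n}. 0 \<odot> a l) = (\<Oplus>l\<in>{1..n}. \<zero>)"
    by (rule finsum_cong') (use smult_zero_left basis_in_carrier in auto)
  then show ?case by simp
next
  case (insert m S)
  have dK: "\<And>m'. m' \<in> insert m S \<Longrightarrow> d m' \<in> K" using insert.prems by auto
  have eK: "\<And>m' l. m' \<in> insert m S \<Longrightarrow> l \<in> {1..n} \<Longrightarrow> e m' l \<in> K" using insert.prems by blast
  have sK: "(\<Sum>m\<in>S. d m * e m l) \<in> K" if "l \<in> {1..n}" for l
    using that dK eK by (auto intro!: scalar_sum scalar_mult)
  have cl: "(\<Oplus>l\<in>{1..n}. e m' l \<odot> a l) \<in> carrier A" if "m' \<in> insert m S" for m'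
    using eK[OF that] basis_in_carrier smult_in_carrier by (intro finsum_closed) auto
  have "(\<Oplus>m\<in>insert m S. d m \<odot> (\<Oplus>l\<in>{1..n}. e m l \<odot> a l))
      = d m \<odot> (\<Oplus>l\<in>{1..n}. e m l \<odot> a l) \<oplus> (\<Oplus>m\<in>S. d m \<odot> (\<Oplus>l\<in>{1..n}. e m l \<odot> a l))"
    using insert.hyps cl dK smult_in_carrier by (intro finsum_insert) auto
  also have "d m \<odot> (\<Oplus>l\<in>{1..n}. e m l \<odot> a l) = (\<Oplus>l\<in>{1..n}. d m \<odot> (e m l \<odot> a l))"
    using dK eK basis_in_carrier smult_in_carrier by (intro smult_finsum) auto
  also have "(\<Oplus>m\<in>S. d m \<odot> (\<Oplus>l\<in>{1..n}. e m l \<odot> a l)) = (\<Oplus>l\<in>{1..n}. (\<Sum>m\<in>S. d m * e m l) \<odot> a l)"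
    using insert.IH insert.prems by auto
  also have "(\<Oplus>l\<in>{1..n}. d m \<odot> (e m l \<odot> a l)) \<oplus> (\<Oplus>l\<in>{1..n}. (\<Sum>m\<in>S. d m * e m l) \<odot> a l)
     = (\<Oplus>l\<in>{1..n}. d m \<odot> (e m l \<odot> a l) \<oplus> (\<Sum>m\<in>S. d m * e m l) \<odot> a l)"
    using dK eK sK basis_in_carrier smult_in_carrier by (intro finsum_addf[symmetric]) auto
  also have "\<dots> = (\<Oplus>l\<in>{1..n}. (\<Sum>m\<in>insert m S. d m * e m l) \<odot> a l)"
    using insert.hyps dK eK sK basis_in_carrier
    by (intro finsum_cong')
      (auto simp: smult_add_left smult_smult scalar_mult scalar_add intro!: smult_in_carrier)
  finally show ?case .
qed

lemma constants_assoc: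
  assumes i: "i \<in> {1..n}" and j: "j \<in> {1..n}" and k: "k \<in> {1..n}" and l: "l \<in> {1..n}"
  shows "(\<Sum>m\<in>{1..n}. \<gamma> i j m * \<gamma> m k l) = (\<Sum>m\<in>{1..n}. \<gamma> j k m * \<gamma> i m l)"
proof -
  let ?g = "\<lambda>i j k. complex_of_real (\<gamma> i j k)"
  note closed = i j k basis_in_carrier constants_scalar smult_in_carrier
  have "(a i \<otimes> a j) \<otimes> a k = (\<Oplus>m\<in>{1..n}. ?g i j m \<odot> a m) \<otimes> a k"
    using i j by (simp add: basis_mult)
  also have "\<dots> = (\<Oplus>m\<in>{1..n}. (?g i j m \<odot> a m) \<otimes> a k)"
    using closed by (intro finsum_ldistr) auto
  also have "\<dots> = (\<Oplus>m\<in>{1..n}. ?g i j m \<odot> (\<Oplus>l\<in>{1..n}. ?g m k l \<odot> a l))"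
    using closed
    by (intro finsum_cong') (auto simp: smult_mult_left basis_mult intro!: smult_in_carrier finsum_closed)
  also have "\<dots> = (\<Oplus>l\<in>{1..n}. (\<Sum>m\<in>{1..n}. ?g i j m * ?g m k l) \<odot> a l)"
    using closed by (intro linear_combination_of_linear_combinations) auto
  finally have left: "(a i \<otimes> a j) \<otimes> a k = \<dots>" .
  have "a i \<otimes> (a j \<otimes> a k) = a i \<otimes> (\<Oplus>m\<in>{1..n}. ?g j k m \<odot> a m)"
    using j k by (simp add: basis_mult)
  also have "\<dots> = (\<Oplus>m\<in>{1..n}. a i \<otimes> (?g j k m \<odot> a m))"
    using closed by (intro finsum_rdistr) auto
  also have "\<dots> = (\<Oplus>m\<in>{1..n}. ?g j k m \<odot> (\<Oplus>l\<in>{1..n}. ?g i m l \<odot> a l))"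
    using closed
    by (intro finsum_cong') (auto simp: smult_mult_right basis_mult intro!: smult_in_carrier finsum_closed)
  also have "\<dots> = (\<Oplus>l\<in>{1..n}. (\<Sum>m\<in>{1..n}. ?g j k m * ?g i m l) \<odot> a l)"
    using closed by (intro linear_combination_of_linear_combinations) auto
  finally have "(\<Oplus>l\<in>{1..n}. (\<Sum>m\<in>{1..n}. ?g i j m * ?g m k l) \<odot> a l)
      = (\<Oplus>l\<in>{1..n}. (\<Sum>m\<in>{1..n}. ?g j k m * ?g i m l) \<odot> a l)"
    using left closed by (simp add: m_assoc)
  then have "(\<Sum>m\<in>{1..n}. ?g i j m * ?g m k l) = (\<Sum>m\<in>{1..n}. ?g j k m * ?g i m l)"
    using i j k constants_scalar
    by (intro coefficients_unique[OF _ _ _ l]) (auto intro!: scalar_sum scalar_mult)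
  then have "complex_of_real (\<Sum>m\<in>{1..n}. \<gamma> i j m * \<gamma> m k l)
      = complex_of_real (\<Sum>m\<in>{1..n}. \<gamma> j k m * \<gamma> i m l)"
    by simp
  then show ?thesis
    by (simp only: of_real_eq_iff)
qed

lemma constants_unit:
  assumes i: "i \<in> {1..n}"
  shows "\<gamma> 1 i i = 1" and "\<gamma> i 1 i = 1"
proof -
  have one: "1 \<in> {1..n}" using dim_pos by simp
  have "(\<Oplus>k\<in>{1..n}. (if k = i then 1 else 0) \<odot> a k) = (\<Oplus>k\<in>{1..n}. if i = k then a k else \<zero>)"
    by (rule finsum_cong') (auto simp: smult_zero_left smult_one_left basis_in_carrier)
  also have "\<dots> = a i"
    using i basis_in_carrier by (intro finsum_singleton) auto
  finally have ai: "(\<Oplus>k\<in>{1..n}. (if k = i then 1 else 0) \<odot> a k) = a i" .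
  have "a i \<otimes> a 1 = a i" "a 1 \<otimes> a i = a i"
    using i basis_in_carrier by (simp_all only: basis_unit l_one r_one)
  then have "(\<Oplus>k\<in>{1..n}. complex_of_real (\<gamma> i 1 k) \<odot> a k) = a i"
    "(\<Oplus>k\<in>{1..n}. complex_of_real (\<gamma> 1 i k) \<odot> a k) = a i"
    using basis_mult i one by auto
  then have "complex_of_real (\<gamma> i 1 i) = (if i = i then 1 else 0)"
    and "complex_of_real (\<gamma> 1 i i) = (if i = i then 1 else 0)"
    using i one constants_scalar scalar_zero scalar_one
    by (intro coefficients_unique[OF _ _ trans[OF _ ai[symmetric]] i]; auto)+
  then show "\<gamma> 1 i i = 1" "\<gamma> i 1 i = 1" by auto
qed

section \<open>The left and the two-sided preorder\<close>

text \<open>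
  Nonnegative terms cannot cancel, so \<open>constants_assoc\<close> passes to the multisemigroup of indices:
  it says \<open>(s \<star> i) \<star> t = s \<star> (i \<star> t)\<close>.
\<close>

lemma star_assoc:
  assumes "s \<in> {1..n}" "i \<in> {1..n}" "t \<in> {1..n}" "k \<in> {1..n}"
  shows "(\<exists>m\<in>{1..n}. \<gamma> s i m > 0 \<and> \<gamma> m t k > 0) \<longleftrightarrow> (\<exists>m\<in>{1..n}. \<gamma> i t m > 0 \<and> \<gamma> s m k > 0)"
proof -
  have pos: "(\<Sum>m\<in>{1..n}. f m * g m) > 0 \<longleftrightarrow> (\<exists>m\<in>{1..n}. f m > 0 \<and> g m > 0)"
    if "\<And>m. m \<in> {1..n} \<Longrightarrow> f m \<ge> 0" "\<And>m. m \<in> {1..n} \<Longrightarrow> g m \<ge> 0" for f g :: "nat \<Rightarrow> real"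
  proof
    assume "(\<Sum>m\<in>{1..n}. f m * g m) > 0"
    then obtain m where "m \<in> {1..n}" "f m * g m > 0"
      using sum_nonpos[of "{1..n}" "\<lambda>m. f m * g m"] by (meson not_less)
    then show "\<exists>m\<in>{1..n}. f m > 0 \<and> g m > 0"
      using that by (metis less_eq_real_def mult_zero_left mult_zero_right less_irrefl)
  next
    assume "\<exists>m\<in>{1..n}. f m > 0 \<and> g m > 0"
    then obtain m where "m \<in> {1..n}" "f m * g m > 0" by auto
    then show "(\<Sum>m\<in>{1..n}. f m * g m) > 0"
      using that by (intro sum_pos2[of _ m]) auto
  qed
  show ?thesis
    using constants_assoc[OF assms] assms constants_nonneg
      pos[of "\<gamma> s i" "\<lambda>m. \<gamma> m t k"] pos[of "\<gamma> i t" "\<lambda>m. \<gamma> s m k"]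
    by auto
qed

lemma le_L_iff: "le_L n \<gamma> i j \<longleftrightarrow> (\<exists>s\<in>{1..n}. j \<in> {1..n} \<and> \<gamma> s i j > 0)"
  by (auto simp: le_L_def star_def)

lemma le_J_iff: "le_J n \<gamma> i j \<longleftrightarrow>
    (\<exists>s\<in>{1..n}. \<exists>t\<in>{1..n}. \<exists>m\<in>{1..n}. j \<in> {1..n} \<and> \<gamma> s i m > 0 \<and> \<gamma> m t j > 0)"
  unfolding le_J_def star_def by blast

lemma le_L_refl: "i \<in> {1..n} \<Longrightarrow> le_L n \<gamma> i i"
  using constants_unit[of i] dim_pos by (auto simp: le_L_iff intro!: bexI[of _ 1])

lemma le_L_trans:
  assumes i: "i \<in> {1..n}" and "le_L n \<gamma> i j" "le_L n \<gamma> j k"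
  shows "le_L n \<gamma> i k"
proof -
  obtain s t where "s \<in> {1..n}" "t \<in> {1..n}" "j \<in> {1..n}" "k \<in> {1..n}"
      "\<gamma> s i j > 0" "\<gamma> t j k > 0"
    using assms(2,3) le_L_iff by auto
  then show ?thesis
    using star_assoc[of t s i k] i le_L_iff by blast
qed

lemma le_L_imp_le_J:
  assumes "le_L n \<gamma> i j"
  shows "le_J n \<gamma> i j"
proof -
  obtain s where "s \<in> {1..n}" "j \<in> {1..n}" "\<gamma> s i j > 0"
    using assms le_L_iff by auto
  moreover from this have "\<gamma> j 1 j > 0"
    using constants_unit by simp
  moreover have "1 \<in> {1..n}"
    using dim_pos by simp
  ultimately show ?thesis
    using le_J_iff by blast
qed

lemma le_J_trans:
  assumes i: "i \<in> {1..n}" and "le_J n \<gamma> i j" "le_J n \<gamma> j k"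
  shows "le_J n \<gamma> i k"
proof -
  obtain s t m where 1: "s \<in> {1..n}" "t \<in> {1..n}" "m \<in> {1..n}" "j \<in> {1..n}"
      "\<gamma> s i m > 0" "\<gamma> m t j > 0"
    using assms(2) le_J_iff by auto
  obtain s' t' m' where 2: "s' \<in> {1..n}" "t' \<in> {1..n}" "m' \<in> {1..n}" "k \<in> {1..n}"
      "\<gamma> s' j m' > 0" "\<gamma> m' t' k > 0"
    using assms(3) le_J_iff by auto
  obtain p where p: "p \<in> {1..n}" "\<gamma> s' m p > 0" "\<gamma> p t m' > 0"
    using star_assoc[of s' m t m'] 1 2 by blast
  obtain q where q: "q \<in> {1..n}" "\<gamma> s' s q > 0" "\<gamma> q i p > 0"
    using star_assoc[of s' s i p] 1 2 p i by blast
  obtain r where r: "r \<in> {1..n}" "\<gamma> t t' r > 0" "\<gamma> p r k > 0"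
    using star_assoc[of p t t' k] 1 2 p by blast
  show ?thesis
    using p q r 2 le_J_iff by blast
qed

section \<open>Left cells inside a two-sided cell\<close>

text \<open>
  The matrix lemma is applied on the two-sided cell \<open>C\<close> of \<open>i\<close>, with \<open>V\<close> the set of elements of \<open>C\<close>
  that are not above \<open>j\<close> in the left order. Left multiplication cannot lead back into \<open>V\<close>, and
  it leads from \<open>i\<close> to \<open>j\<close>, which is outside \<open>V\<close>. So it must not start in \<open>V\<close>: \<open>i\<close> is above \<open>j\<close>.
\<close>

lemma left_comparable_imp_left_equivalent:
  assumes i: "i \<in> {1..n}" and j: "j \<in> {1..n}" and ij: "le_L n \<gamma> i j" and ji: "le_J n \<gamma> j i"
  shows "le_L n \<gamma> j i"
proof (rule ccontr)
  assume contra: "\<not> le_L n \<gamma> j i"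
  define C where "C = {m \<in> {1..n}. le_J n \<gamma> i m \<and> le_J n \<gamma> m i}"
  \<comment> \<open>left and right multiplication by the sum of all basis elements\<close>
  define Q where "Q k l = (\<Sum>s\<in>{1..n}. \<gamma> s l k)" for k l
  define R where "R k l = (\<Sum>t\<in>{1..n}. \<gamma> l t k)" for k l
  define V where "V = {m \<in> C. \<not> le_L n \<gamma> j m}"
  have C: "finite C" "C \<subseteq> {1..n}" "V \<subseteq> C" by (auto simp: C_def V_def)
  have nonneg: "0 \<le> Q k l" "0 \<le> R k l" if "k \<in> C" "l \<in> C" for k l
    unfolding Q_def R_def using that C(2) by (auto intro!: sum_nonneg constants_nonneg)
  have Q_pos: "0 < Q k l" if "\<gamma> s l k > 0" "s \<in> {1..n}" "k \<in> {1..n}" "l \<in> {1..n}" for s k l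
    unfolding Q_def using that constants_nonneg by (intro sum_pos2[of _ s]) auto
  have R_pos: "0 < R k l" if "\<gamma> l t k > 0" "t \<in> {1..n}" "k \<in> {1..n}" "l \<in> {1..n}" for t k l
    unfolding R_def using that constants_nonneg by (intro sum_pos2[of _ t]) auto
  have convex: "m \<in> C"
    if "l \<in> C" "k \<in> C" "m \<in> {1..n}" "le_J n \<gamma> l m" "le_J n \<gamma> m k" for k l m
    using that le_J_trans[of i l m] le_J_trans[of m k i] i C by (auto simp: C_def)
  \<comment> \<open>The two-sided order multiplies on both sides; here the left factor is the unit.\<close>
  have right: "le_J n \<gamma> l m" if "\<gamma> l t m > 0" "t \<in> {1..n}" "m \<in> {1..n}" "l \<in> {1..n}" for l t m
  proof -
    have "1 \<in> {1..n}" "\<gamma> 1 l l > 0"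
      using that dim_pos constants_unit[of l] by auto
    then show ?thesis using that le_J_iff by blast
  qed
  have left: "le_J n \<gamma> l m" if "\<gamma> s l m > 0" "s \<in> {1..n}" "m \<in> {1..n}" for l s m
    using that le_L_imp_le_J le_L_iff by blast
  \<comment> \<open>Associativity gives this with the intermediate index \<open>m\<close> ranging over the whole basis. An \<open>m\<close>
    with a nonzero contribution lies between two elements of \<open>C\<close>, hence in \<open>C\<close>.\<close>
  have comm: "mat_mult_on C Q R k l = mat_mult_on C R Q k l" if k: "k \<in> C" and l: "l \<in> C" for k l
  proof -
    have kn: "k \<in> {1..n}" and ln: "l \<in> {1..n}" using k l C by auto
    have QR: "\<gamma> l t m * \<gamma> s m k = 0"
      if "s \<in> {1..n}" "t \<in> {1..n}" "m \<in> {1..n} - C" for s t m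
    proof (rule ccontr)
      assume "\<gamma> l t m * \<gamma> s m k \<noteq> 0"
      then have "\<gamma> l t m > 0" "\<gamma> s m k > 0"
        using that kn ln constants_nonneg by (auto simp: less_le)
      then show False
        using convex[OF l k, of m] right[of l t m] left[of s m k] that kn ln by auto
    qed
    have RQ: "\<gamma> s l m * \<gamma> m t k = 0"
      if "s \<in> {1..n}" "t \<in> {1..n}" "m \<in> {1..n} - C" for s t m
    proof (rule ccontr)
      assume "\<gamma> s l m * \<gamma> m t k \<noteq> 0"
      then have "\<gamma> s l m > 0" "\<gamma> m t k > 0"
        using that kn ln constants_nonneg by (auto simp: less_le)
      then show False
        using convex[OF l k, of m] left[of s l m] right[of m t k] that kn ln by auto
    qed
    have "mat_mult_on C Q R k l = (\<Sum>m\<in>C. \<Sum>s\<in>{1..n}. \<Sum>t\<in>{1..n}. \<gamma> l t m * \<gamma> s m k)"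
      by (simp add: mat_mult_on_def Q_def R_def sum_product mult.commute)
    also have "\<dots> = (\<Sum>s\<in>{1..n}. \<Sum>m\<in>C. \<Sum>t\<in>{1..n}. \<gamma> l t m * \<gamma> s m k)"
      by (rule sum.swap)
    also have "\<dots> = (\<Sum>s\<in>{1..n}. \<Sum>t\<in>{1..n}. \<Sum>m\<in>C. \<gamma> l t m * \<gamma> s m k)"
      by (intro sum.cong refl sum.swap)
    also have "\<dots> = (\<Sum>s\<in>{1..n}. \<Sum>t\<in>{1..n}. \<Sum>m\<in>{1..n}. \<gamma> l t m * \<gamma> s m k)"
      using C QR by (intro sum.cong refl sum.mono_neutral_left) auto
    also have "\<dots> = (\<Sum>s\<in>{1..n}. \<Sum>t\<in>{1..n}. \<Sum>m\<in>{1..n}. \<gamma> s l m * \<gamma> m t k)"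
      using kn ln by (intro sum.cong refl constants_assoc[symmetric]) auto
    also have "\<dots> = (\<Sum>s\<in>{1..n}. \<Sum>t\<in>{1..n}. \<Sum>m\<in>C. \<gamma> s l m * \<gamma> m t k)"
      using C RQ by (intro sum.cong refl sum.mono_neutral_right) auto
    also have "\<dots> = (\<Sum>s\<in>{1..n}. \<Sum>m\<in>C. \<Sum>t\<in>{1..n}. \<gamma> s l m * \<gamma> m t k)"
      by (intro sum.cong refl sum.swap)
    also have "\<dots> = (\<Sum>m\<in>C. \<Sum>s\<in>{1..n}. \<Sum>t\<in>{1..n}. \<gamma> s l m * \<gamma> m t k)"
      by (rule sum.swap)
    also have "\<dots> = (\<Sum>m\<in>C. Q m l * R k m)"
      by (simp add: Q_def R_def sum_product)
    finally show ?thesis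
      by (simp add: mat_mult_on_def mult.commute)
  qed
  have positive: "0 < mat_mult_on C R Q k l" if k: "k \<in> C" and l: "l \<in> C" for k l
  proof -
    have kn: "k \<in> {1..n}" and ln: "l \<in> {1..n}" using k l C by auto
    have "le_J n \<gamma> l k"
      using k l i le_J_trans[of l i k] by (auto simp: C_def)
    then obtain s t m where *: "s \<in> {1..n}" "t \<in> {1..n}" "m \<in> {1..n}" "\<gamma> s l m > 0" "\<gamma> m t k > 0"
      using le_J_iff by auto
    then have "m \<in> C"
      using convex[OF l k] left right kn by blast
    moreover have "0 < R k m * Q m l"
      using * R_pos Q_pos kn ln by (intro mult_pos_pos) blast+
    ultimately show ?thesis
      unfolding mat_mult_on_def using C nonneg k l by (intro sum_pos2[of _ m]) auto
  qed
  have comm': "mat_mult_on C Q (mat_mult_on C R Q) k l = mat_mult_on C (mat_mult_on C R Q) Q k l" if "k \<in> C" "l \<in> C" for k l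
  proof -
    have "mat_mult_on C Q (mat_mult_on C R Q) k l = mat_mult_on C (mat_mult_on C Q R) Q k l"
      by (simp add: mat_mult_on_assoc)
    also have "\<dots> = mat_mult_on C (mat_mult_on C R Q) Q k l"
      by (rule mat_mult_on_cong) (use that comm in auto)
    finally show ?thesis .
  qed
  have "Q j i = 0"
  proof (rule commuting_positive_imp_decoupled[OF C(1) nonneg(1) positive comm' C(3)])
    show "i \<in> V" "j \<in> C - V"
      using contra i j ij ji le_L_refl le_L_imp_le_J by (auto simp: V_def C_def)
    fix k l assume k: "k \<in> V" and l: "l \<in> C - V"
    have kn: "k \<in> {1..n}" and ln: "l \<in> {1..n}" using k l C by auto
    have "\<gamma> s l k = 0" if "s \<in> {1..n}" for s
    proof (rule ccontr)
      assume "\<gamma> s l k \<noteq> 0"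
      then have "le_L n \<gamma> l k"
        using constants_nonneg[OF that ln kn] that kn by (auto simp: le_L_iff less_le)
      moreover have "le_L n \<gamma> j l"
        using l by (auto simp: V_def)
      ultimately show False
        using le_L_trans[OF j] k by (auto simp: V_def)
    qed
    then show "Q k l = 0" by (simp add: Q_def)
  qed
  moreover have "0 < Q j i"
    using ij i j Q_pos le_L_iff by blast
  ultimately show False by simp
qed

lemma equiv_left: "equiv {1..n} {(i, j) \<in> {1..n} \<times> {1..n}. le_L n \<gamma> i j \<and> le_L n \<gamma> j i}"
  by (rule equivI) (auto intro!: refl_onI symI transI intro: le_L_refl le_L_trans)

lemma equiv_two_sided: "equiv {1..n} {(i, j) \<in> {1..n} \<times> {1..n}. le_J n \<gamma> i j \<and> le_J n \<gamma> j i}"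
  by (rule equivI)
    (auto intro!: refl_onI symI transI le_L_imp_le_J[OF le_L_refl] intro: le_J_trans)

lemma comparable_left_cells_eq:
  assumes I: "I \<in> two_sided_cells n \<gamma>" and L: "L \<in> left_cells n \<gamma>" "L' \<in> left_cells n \<gamma>"
    and sub: "L \<subseteq> I" "L' \<subseteq> I" and le: "cell_le_L n \<gamma> L L'"
  shows "L = L'"
proof -
  obtain i j where ij: "i \<in> L" "j \<in> L'" "le_L n \<gamma> i j"
    using le cell_le_L_def by auto
  have "(i, j) \<in> {(i, j) \<in> {1..n} \<times> {1..n}. le_J n \<gamma> i j \<and> le_J n \<gamma> j i}"
    using quotient_eq_iff[OF equiv_two_sided, of I I i j] I ij sub by (auto simp: two_sided_cells_def)
  then have *: "i \<in> {1..n}" "j \<in> {1..n}" "le_J n \<gamma> j i" by auto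
  then have "(i, j) \<in> {(i, j) \<in> {1..n} \<times> {1..n}. le_L n \<gamma> i j \<and> le_L n \<gamma> j i}"
    using ij left_comparable_imp_left_equivalent by auto
  then show ?thesis
    using quotient_eqI[OF equiv_left] L ij by (auto simp: left_cells_def)
qed

end

theorem corollary19:
  fixes K :: "complex set" and A :: "(complex, 'a) module" and n :: nat
    and a :: "nat \<Rightarrow> 'a" and \<gamma> :: "nat \<Rightarrow> nat \<Rightarrow> nat \<Rightarrow> real" and I J :: "nat set"
  assumes "positively_based_algebra K A n a \<gamma>"
    and "I \<in> two_sided_cells n \<gamma>"
    and "is_apex_two_sided K A n a \<gamma> I J"
    and "\<forall>x\<in>apex_ideal K A n a \<gamma> J. \<forall>v\<in>carrier (two_sided_cell_module K A n a \<gamma> I).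
           x \<odot>\<^bsub>two_sided_cell_module K A n a \<gamma> I\<^esub> v = \<zero>\<^bsub>two_sided_cell_module K A n a \<gamma> I\<^esub>"
  shows "\<forall>L\<in>left_cells n \<gamma>. \<forall>L'\<in>left_cells n \<gamma>. L \<subseteq> I \<and> L' \<subseteq> I \<and> L \<noteq> L' \<longrightarrow>
           \<not> cell_le_L n \<gamma> L L' \<and> \<not> cell_le_L n \<gamma> L' L"
  using positively_based_algebra.comparable_left_cells_eq[OF assms(1,2)] by metis

end
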